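(* Let $G$ be a finite connected graph, let $H$ be a retract of $G$, and let $k$ be a non-negative integer. If $G \in \mathcal{CWRC}(k)$, then $H \in \mathcal{CWRC}(k)$.
   Context: All graphs are finite and simple. Cop and robber game with radius of capture $k$ on a graph $G$: first the cop chooses a vertex, then the robber chooses a vertex; afterwards, starting with the cop, the players alternately either move to an adjacent vertex or stay at their current vertex, both always knowing both positions. The cop wins if at some point of the game the distance $d_G$ between the cop's and the robber's vertices is at most $k$; the robber wins if this never happens. $\mathcal{CWRC}(k)$ denotes the class of graphs on which the cop has a winning strategy in this game regardless of the robber's play. An induced subgraph $H$ of $G$ is a retract of $G$ if there is a map $f:V(G)\to V(H)$ that maps edges to edges (if $xy\in E(G)$ then $f(x)f(y)\in E(H)$) and satisfies $f(h)=h$ for all $h\in V(H)$. *)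

theory Defs
  imports "Graph_Theory.Graph_Theory"
begin

text \<open>
  A finite simple graph is a \<^locale>\<open>pair_graph\<close>: a finite loopless digraph whose arc set is
  symmetric, each edge \<open>xy\<close> being represented by the two arcs \<open>(x, y)\<close> and \<open>(y, x)\<close>.
\<close>

text \<open>Least number of edges of a walk from \<open>u\<close> to \<open>v\<close>; \<open>\<infinity>\<close> if there is none.\<close>

definition graph_dist :: "'a pair_pre_digraph \<Rightarrow> 'a \<Rightarrow> 'a \<Rightarrow> ereal" where
  "graph_dist G u v = wf_digraph.\<mu> (with_proj G) (\<lambda>_. 1) u v"

definition graph_retract :: "'a pair_pre_digraph \<Rightarrow> 'a pair_pre_digraph \<Rightarrow> bool" where
  "graph_retract H G \<longleftrightarrow>
     induced_subgraph (with_proj H) (with_proj G) \<and>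
     (\<exists>f. f \<in> pverts G \<rightarrow> pverts H \<and>
          (\<forall>x y. (x, y) \<in> parcs G \<longrightarrow> (f x, f y) \<in> parcs H) \<and>
          (\<forall>h \<in> pverts H. f h = h))"

definition legal_move :: "'a pair_pre_digraph \<Rightarrow> 'a \<Rightarrow> 'a \<Rightarrow> bool" where
  "legal_move G u v \<longleftrightarrow> u \<in> pverts G \<and> v \<in> pverts G \<and> (u = v \<or> (u, v) \<in> parcs G)"

text \<open>
  Whenever it is the cop's turn, the history is the list of pairs (cop's vertex, robber's vertex)
  at the ends of the rounds completed so far. A cop strategy maps it to the cop's next vertex;
  the empty history yields the cop's initial vertex.
\<close>

definition cop_strategy :: "'a pair_pre_digraph \<Rightarrow> (('a \<times> 'a) list \<Rightarrow> 'a) \<Rightarrow> bool" where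
  "cop_strategy G s \<longleftrightarrow>
     s [] \<in> pverts G \<and>
     (\<forall>h. h \<noteq> [] \<and> set h \<subseteq> pverts G \<times> pverts G \<longrightarrow> legal_move G (fst (last h)) (s h))"

text \<open>In round \<open>n\<close> the cop goes to \<open>c n\<close> and then the robber goes to \<open>r n\<close>;
  round \<open>0\<close> consists of the initial choices.\<close>

definition follows_strategy ::
    "(('a \<times> 'a) list \<Rightarrow> 'a) \<Rightarrow> (nat \<Rightarrow> 'a) \<Rightarrow> (nat \<Rightarrow> 'a) \<Rightarrow> bool" where
  "follows_strategy s c r \<longleftrightarrow> (\<forall>n. c n = s (map (\<lambda>i. (c i, r i)) [0..<n]))"

definition robber_play :: "'a pair_pre_digraph \<Rightarrow> (nat \<Rightarrow> 'a) \<Rightarrow> bool" where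
  "robber_play G r \<longleftrightarrow> r 0 \<in> pverts G \<and> (\<forall>n. legal_move G (r n) (r (Suc n)))"

text \<open>The distance is inspected both after the robber's and after the cop's turn.
  Plays are continued after a capture, which does not affect who wins.\<close>

definition captured ::
    "'a pair_pre_digraph \<Rightarrow> nat \<Rightarrow> (nat \<Rightarrow> 'a) \<Rightarrow> (nat \<Rightarrow> 'a) \<Rightarrow> bool" where
  "captured G k c r \<longleftrightarrow>
     (\<exists>n. graph_dist G (c n) (r n) \<le> ereal (real k) \<or>
          graph_dist G (c (Suc n)) (r n) \<le> ereal (real k))"

definition winning_cop_strategy ::
    "'a pair_pre_digraph \<Rightarrow> nat \<Rightarrow> (('a \<times> 'a) list \<Rightarrow> 'a) \<Rightarrow> bool" where
  "winning_cop_strategy G k s \<longleftrightarrow>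
     cop_strategy G s \<and>
     (\<forall>c r. robber_play G r \<and> follows_strategy s c r \<longrightarrow> captured G k c r)"

definition CWRC :: "nat \<Rightarrow> 'a pair_pre_digraph set" where
  "CWRC k = {G. pair_graph G \<and> (\<exists>s. winning_cop_strategy G k s)}"

end

theory Submission
  imports Defs
begin

text \<open>
  The cop plays on \<open>H\<close> the image under the retraction of a winning play on \<open>G\<close> against the same
  robber, whose moves in \<open>H\<close> are also moves in \<open>G\<close>. A graph homomorphism does not increase
  distances, so capture in the game on \<open>G\<close> is also capture in the game on \<open>H\<close>.
\<close>

lemma wf_digraph_with_proj:
  assumes "pair_graph G"
  shows "wf_digraph (with_proj G)"
proof -
  interpret graph "with_proj G"
    using pair_graph.pair_graphD_graph[OF assms] .
  show ?thesis ..
qed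

text \<open>Having all arcs of \<open>G\<close> between its vertices, \<open>H\<close> keeps both
  arcs of each edge, so symmetry is inherited. This supplies the \<open>pair_graph H\<close> that
  \<open>CWRC\<close> demands.\<close>

lemma pair_graph_induced_subgraph:
  assumes "pair_graph G" and sub: "induced_subgraph (with_proj H) (with_proj G)"
  shows "pair_graph H"
proof (rule pair_graphI_graph)
  interpret G: graph "with_proj G"
    using pair_graph.pair_graphD_graph[OF assms(1)] .
  interpret H: digraph "with_proj H"
    using G.digraphI_induced[OF sub] .
  interpret H: sym_digraph "with_proj H"
    by (rule G.induced_graph_imp_graph[OF sub])
  show "graph (with_proj H)"
    by unfold_locales
qed

text \<open>Mapping each arc of a walk by \<open>f\<close> gives a walk in \<open>H\<close> with
  equally many arcs, and both distances are infima over walks. If no walk from \<open>u\<close> to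
  \<open>v\<close> exists, the bound is \<infinity>.\<close>

lemma graph_dist_hom_le:
  assumes G: "pair_graph G" and H: "pair_graph H"
    and verts: "f \<in> pverts G \<rightarrow> pverts H"
    and arcs: "\<And>x y. (x, y) \<in> parcs G \<Longrightarrow> (f x, f y) \<in> parcs H"
  shows "graph_dist H (f u) (f v) \<le> graph_dist G u v"
proof -
  note mu = wf_digraph.\<mu>_def[OF wf_digraph_with_proj]
    and cost = wf_digraph.awalk_cost_def[OF wf_digraph_with_proj]
  show ?thesis
    unfolding graph_dist_def mu[OF G] mu[OF H]
  proof (rule INF_mono)
    fix p assume "p \<in> {p. pre_digraph.awalk (with_proj G) u p v}"
    then have p: "u \<in> pverts G" "set p \<subseteq> parcs G" "pcas u p v"
      by (simp_all add: pre_digraph.awalk_def cas_with_proj_eq)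
    let ?q = "map (map_prod f f) p"
    from p(3) have "pcas (f u) ?q (f v)"
      by (induction p arbitrary: u) auto
    moreover have "set ?q \<subseteq> parcs H"
      using p(2) arcs by auto
    ultimately have "pre_digraph.awalk (with_proj H) (f u) ?q (f v)"
      using p(1) verts by (auto simp: pre_digraph.awalk_def cas_with_proj_eq)
    then show "\<exists>q\<in>{q. pre_digraph.awalk (with_proj H) (f u) q (f v)}.
        ereal (wf_digraph.awalk_cost (\<lambda>_. 1) q) \<le> ereal (wf_digraph.awalk_cost (\<lambda>_. 1) p)"
      by (intro bexI[of _ ?q]) (simp_all add: cost[OF G] cost[OF H] o_def)
  qed
qed

lemma legal_move_hom:
  assumes "f \<in> pverts G \<rightarrow> pverts H"
    and "\<And>x y. (x, y) \<in> parcs G \<Longrightarrow> (f x, f y) \<in> parcs H"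
    and "legal_move G u v"
  shows "legal_move H (f u) (f v)"
  using assms unfolding legal_move_def by auto

lemma legal_move_subgraph:
  assumes "pverts H \<subseteq> pverts G" "parcs H \<subseteq> parcs G" "legal_move H u v"
  shows "legal_move G u v"
  using assms unfolding legal_move_def by auto

text \<open>Built from the robber's vertices alone: a history on \<open>H\<close> records only
  images under \<open>f\<close> of the cop's vertices on \<open>G\<close>, which need not determine
  those vertices.\<close>

definition strategy_history :: "(('a \<times> 'a) list \<Rightarrow> 'a) \<Rightarrow> 'a list \<Rightarrow> ('a \<times> 'a) list" where
  "strategy_history s rs = foldl (\<lambda>h r. h @ [(s h, r)]) [] rs"

lemma strategy_history_Nil [simp]: "strategy_history s [] = []"
  by (simp add: strategy_history_def)

lemma strategy_history_snoc [simp]: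
  "strategy_history s (rs @ [r]) = strategy_history s rs @ [(s (strategy_history s rs), r)]"
  by (simp add: strategy_history_def)

text \<open>Provides a play of \<open>s\<close> against any \<open>r\<close>: the recursion over
  prefixes resolves the self-reference of \<open>c\<close> in
  \<open>follows_strategy\<close>.\<close>

lemma follows_strategy_history:
  "follows_strategy s (\<lambda>n. s (strategy_history s (map r [0..<n]))) r"
proof -
  have hist: "strategy_history s (map r [0..<n]) =
      map (\<lambda>i. (s (strategy_history s (map r [0..<i])), r i)) [0..<n]" for n
    by (induction n) simp_all
  then show ?thesis
    unfolding follows_strategy_def by (intro allI arg_cong[of _ _ s] hist)
qed

lemma robber_play_in_verts:
  assumes "robber_play G r"
  shows "r n \<in> pverts G"
  using assms unfolding robber_play_def legal_move_def by blast

text \<open>\<open>cop_strategy\<close> promises legality only on histories inside \<open>G\<close>,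
  so an induction first shows that the cop stays in \<open>G\<close>.\<close>

lemma follows_cop_strategy_legal:
  assumes cop: "cop_strategy G s" and fol: "follows_strategy s c r"
    and r: "\<And>n. r n \<in> pverts G"
  shows "c 0 \<in> pverts G" and "legal_move G (c n) (c (Suc n))"
proof -
  have c: "c n = s (map (\<lambda>i. (c i, r i)) [0..<n])" for n
    using fol unfolding follows_strategy_def by blast
  show c0: "c 0 \<in> pverts G"
    using c[of 0] cop by (simp add: cop_strategy_def)
  have step: "legal_move G (c n) (c (Suc n))" if "\<forall>i\<le>n. c i \<in> pverts G" for n
  proof -
    let ?h = "map (\<lambda>i. (c i, r i)) [0..<Suc n]"
    have "set ?h \<subseteq> pverts G \<times> pverts G"
      using that r by (auto simp: less_Suc_eq_le)
    moreover have "?h \<noteq> []"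
      by simp
    ultimately have "legal_move G (fst (last ?h)) (s ?h)"
      using cop unfolding cop_strategy_def by metis
    then show ?thesis
      using c[of "Suc n"] by simp
  qed
  have "\<forall>i\<le>n. c i \<in> pverts G" for n
  proof (induction n)
    case (Suc n)
    then show ?case
      using step[of n] by (auto simp: le_Suc_eq legal_move_def)
  qed (simp add: c0)
  then show "legal_move G (c n) (c (Suc n))"
    using step by blast
qed

text \<open>Legality is demanded on all histories, also on those that no play produces;
  on the latter the image move may be illegal, and the cop stays put instead.\<close>

definition retract_strategy ::
    "'a pair_pre_digraph \<Rightarrow> ('a \<Rightarrow> 'a) \<Rightarrow> (('a \<times> 'a) list \<Rightarrow> 'a) \<Rightarrow> ('a \<times> 'a) list \<Rightarrow> 'a" where
  "retract_strategy H f s h =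
     (let v = f (s (strategy_history s (map snd h))) in
      if h = [] \<or> legal_move H (fst (last h)) v then v else fst (last h))"

lemma cop_strategy_retract_strategy:
  assumes "f (s []) \<in> pverts H"
  shows "cop_strategy H (retract_strategy H f s)"
proof -
  have "fst (last h) \<in> pverts H" if "h \<noteq> []" "set h \<subseteq> pverts H \<times> pverts H" for h
    using last_in_set[OF that(1)] that(2) by auto
  then show ?thesis
    using assms by (auto simp: cop_strategy_def retract_strategy_def Let_def legal_move_def)
qed

text \<open>In an actual play the fallback of staying put never matters: as long as the cop stands
  on the image vertex, the image move passes the legality test.\<close>

lemma follows_retract_strategy:
  assumes fol: "follows_strategy (retract_strategy H f s) c r"
    and legal: "\<And>n. legal_move H (f (s (strategy_history s (map r [0..<n]))))
      (f (s (strategy_history s (map r [0..<Suc n]))))"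
  shows "c n = f (s (strategy_history s (map r [0..<n])))"
proof -
  let ?h = "\<lambda>n. map (\<lambda>i. (c i, r i)) [0..<n]"
  have c: "c n = retract_strategy H f s (?h n)" for n
    using fol unfolding follows_strategy_def by blast
  have snd_h: "map snd (?h n) = map r [0..<n]" for n
    by simp
  show ?thesis
  proof (induction n)
    case 0
    show ?case
      unfolding c[of 0] retract_strategy_def snd_h by simp
  next
    case (Suc n)
    \<comment> \<open>The history before round \<open>Suc n\<close> ends with round
      \<open>n\<close>, so by the induction hypothesis the test is exactly
      \<open>legal[of n]\<close>.\<close>
    have "fst (last (?h (Suc n))) = c n"
      by simp
    then show ?case
      using legal[of n] unfolding c[of "Suc n"] retract_strategy_def snd_h Suc.IH Let_def
      by presburger
  qed
qed

theorem theorem2p2: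
  fixes G H :: "'a pair_pre_digraph" and k :: nat
  assumes "pair_graph G"
    and "Digraph_Component.connected (with_proj G)"
    and "graph_retract H G"
    and "G \<in> CWRC k"
  shows "H \<in> CWRC k"
proof -
  from \<open>graph_retract H G\<close> obtain f where
    sub: "induced_subgraph (with_proj H) (with_proj G)" and
    verts: "f \<in> pverts G \<rightarrow> pverts H" and
    arcs: "\<And>x y. (x, y) \<in> parcs G \<Longrightarrow> (f x, f y) \<in> parcs H" and
    fix_H: "\<And>h. h \<in> pverts H \<Longrightarrow> f h = h"
    unfolding graph_retract_def by blast
  from \<open>G \<in> CWRC k\<close> obtain s where
    cop: "cop_strategy G s" and
    win: "\<And>c r. robber_play G r \<Longrightarrow> follows_strategy s c r \<Longrightarrow> captured G k c r"
    unfolding CWRC_def winning_cop_strategy_def by blast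
  have H: "pair_graph H"
    using pair_graph_induced_subgraph[OF \<open>pair_graph G\<close> sub] .
  have V: "pverts H \<subseteq> pverts G" and A: "parcs H \<subseteq> parcs G"
    using sub unfolding induced_subgraph_def subgraph_def by simp_all
  have "f (s []) \<in> pverts H"
    using cop verts by (auto simp: cop_strategy_def)
  then have "cop_strategy H (retract_strategy H f s)"
    by (rule cop_strategy_retract_strategy)
  moreover have "captured H k c r"
    if r: "robber_play H r" and fol: "follows_strategy (retract_strategy H f s) c r" for c r
  proof -
    \<comment> \<open>The imagined cop on \<open>G\<close>, who plays \<open>s\<close> against the
      real robber.\<close>
    define C where "C n = s (strategy_history s (map r [0..<n]))" for n
    have C_fol: "follows_strategy s C r"
      using follows_strategy_history[of s r] unfolding C_def .
    have r_H: "r n \<in> pverts H" for n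
      using robber_play_in_verts[OF r] .
    have r_G: "robber_play G r"
      using r V legal_move_subgraph[OF V A] unfolding robber_play_def by blast
    have "legal_move G (C n) (C (Suc n))" for n
      using follows_cop_strategy_legal(2)[OF cop C_fol robber_play_in_verts[OF r_G]] .
    then have "legal_move H (f (C n)) (f (C (Suc n)))" for n
      using legal_move_hom[OF verts arcs] by blast
    then have c: "c n = f (C n)" for n
      using follows_retract_strategy[OF fol] unfolding C_def by blast
    \<comment> \<open>The robber stays in \<open>H\<close>, so \<open>f\<close> fixes
      \<open>r n\<close>. Separate indices \<open>m\<close> and \<open>n\<close> cover both
      inspections in \<open>captured\<close>, after the robber's turn and after the cop's.\<close>
    have dist: "graph_dist H (c m) (r n) \<le> graph_dist G (C m) (r n)" for m n
      using graph_dist_hom_le[OF \<open>pair_graph G\<close> H verts arcs, of "C m" "r n"]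
      by (simp add: c fix_H[OF r_H])
    show ?thesis
      using win[OF r_G C_fol] dist unfolding captured_def by (meson order_trans)
  qed
  ultimately show ?thesis
    using H unfolding CWRC_def winning_cop_strategy_def by blast
qed

end
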